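(* Let $M$ be an $n\times n$ $(0,1)$-matrix such that $M$ or its transpose $M^T$ is equivalent to a matrix of the block form $$\begin{bmatrix} Q & J_{3\times 2} & \ast\\ X & Y & \ast\end{bmatrix},\qquad Q=\begin{bmatrix}1&0\\0&1\\1&1\end{bmatrix},$$ where $X$ and $Y$ are $(n-3)\times 2$ $(0,1)$-matrices and the blocks $\ast$ are arbitrary $(0,1)$-blocks. Suppose further that (1) the columns of $Y$ are mutually orthogonal, and (2) every column of $X$ is orthogonal to every column of $Y$. Then $M$ does not support unitaries.
   Context: Two $(0,1)$-matrices $M_1,M_2$ are equivalent if $PM_1P'=M_2$ for some permutation matrices $P,P'$. $J_{3\times 2}$ is the $3\times 2$ all-ones matrix. Orthogonality of $(0,1)$-vectors means that their usual (real) inner product is $0$. An $n\times n$ $(0,1)$-matrix $M$ supports unitaries if there exists an $n\times n$ complex unitary matrix $U$ such that, for all $i,j$, $U_{ij}\neq 0$ if and only if $M_{ij}=1$. *)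

theory Defs
  imports Complex_Main "Jordan_Normal_Form.Schur_Decomposition"
begin

definition zero_one_mat :: "real mat \<Rightarrow> bool" where
  "zero_one_mat M \<longleftrightarrow> elements_mat M \<subseteq> {0, 1}"

definition permutation_mat :: "nat \<Rightarrow> real mat \<Rightarrow> bool" where
  "permutation_mat n P \<longleftrightarrow>
     (\<exists>p. p permutes {..<n} \<and> P = mat n n (\<lambda>(i, j). if j = p i then 1 else 0))"

definition equivalent_mat :: "real mat \<Rightarrow> real mat \<Rightarrow> bool" where
  "equivalent_mat M\<^sub>1 M\<^sub>2 \<longleftrightarrow>
     (\<exists>P P'. permutation_mat (dim_row M\<^sub>1) P \<and> permutation_mat (dim_col M\<^sub>1) P' \<and>
             P * M\<^sub>1 * P' = M\<^sub>2)"

definition append_cols :: "'a :: zero mat \<Rightarrow> 'a mat \<Rightarrow> 'a mat" (infixr "@\<^sub>c" 65) where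
  "A @\<^sub>c B = four_block_mat A B (0\<^sub>m 0 (dim_col A)) (0\<^sub>m 0 (dim_col B))"

definition Q_mat :: "real mat" where
  "Q_mat = mat_of_rows_list 2 [[1, 0], [0, 1], [1, 1]]"

definition J_mat :: "nat \<Rightarrow> nat \<Rightarrow> real mat" where
  "J_mat r c = mat r c (\<lambda>_. 1)"

definition unitary_mat :: "complex mat \<Rightarrow> bool" where
  "unitary_mat U \<longleftrightarrow>
     square_mat U \<and> inverts_mat U (mat_adjoint U) \<and> inverts_mat (mat_adjoint U) U"

definition supports_unitaries :: "real mat \<Rightarrow> bool" where
  "supports_unitaries M \<longleftrightarrow>
     (\<exists>U \<in> carrier_mat (dim_row M) (dim_col M). unitary_mat U \<and>
        (\<forall>i < dim_row M. \<forall>j < dim_col M. U $$ (i, j) \<noteq> 0 \<longleftrightarrow> M $$ (i, j) = 1))"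

end

theory Submission
  imports Defs
begin

text \<open>Suppose that a unitary \<open>U\<close> is supported on the block matrix, and call its first four
  columns \<open>a\<close>, \<open>b\<close> (over \<open>Q\<close>, \<open>X\<close>) and \<open>c\<close>, \<open>d\<close> (over \<open>J\<close>, \<open>Y\<close>). The entries of \<open>X\<close>
  and \<open>Y\<close> are nonnegative, so by the orthogonality hypotheses the two columns in each of the
  pairs \<open>(a, c)\<close>, \<open>(a, d)\<close>, \<open>(b, c)\<close>, \<open>(b, d)\<close>, \<open>(c, d)\<close> have disjoint supports below
  the third row. Hence these five pairs are orthogonal already in their top three entries. The
  top parts of \<open>a\<close> and \<open>b\<close> are linearly independent because of the shape of \<open>Q\<close>; so the top
  parts of \<open>c\<close> and \<open>d\<close>, being orthogonal to both in three-dimensional space, lie on one line.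
  They are nonzero and orthogonal to each other, which is absurd; this is
  \<open>no_orthogonal_pair_over_Q\<close>.

  The reduction to the block matrix itself uses that rearranging the rows and columns of a unitary
  matrix, or transposing it, leaves it unitary (\<open>supports_unitaries_equivalent\<close>,
  \<open>supports_unitaries_transpose\<close>).\<close>

section \<open>Unitary matrices entrywise\<close>

lemma mat_adjoint_eq_mat:
  assumes "U \<in> carrier_mat n n"
  shows "mat_adjoint U = mat n n (\<lambda>(i, j). cnj (U $$ (j, i)))"
  using assms by (intro eq_matI) (auto simp: mat_adjoint_def mat_of_rows_def)

text \<open>Both products have to be the identity, but for square matrices one of them suffices; so
  the orthonormality of the columns is enough to recognise a unitary matrix.\<close>

lemma unitary_mat_iff_orthonormal_cols:
  fixes U :: "complex mat"
  assumes U: "U \<in> carrier_mat n n"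
  shows "unitary_mat U \<longleftrightarrow>
    (\<forall>i<n. \<forall>j<n. (\<Sum>k<n. cnj (U $$ (k, i)) * U $$ (k, j)) = (if i = j then 1 else 0))"
    (is "_ \<longleftrightarrow> ?orth")
proof -
  let ?A = "mat_adjoint U"
  have A: "?A \<in> carrier_mat n n"
    using U by (simp add: mat_adjoint_eq_mat)
  have entry: "(?A * U) $$ (i, j) = (\<Sum>k<n. cnj (U $$ (k, i)) * U $$ (k, j))"
    if "i < n" "j < n" for i j
    using that U by (simp add: mat_adjoint_eq_mat scalar_prod_def atLeast0LessThan)
  have "?A * U = 1\<^sub>m n \<longleftrightarrow> ?orth"
  proof
    assume "?A * U = 1\<^sub>m n"
    then show ?orth by (metis entry index_one_mat(1))
  next
    assume ?orth
    then show "?A * U = 1\<^sub>m n"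
      using U A by (intro eq_matI) (auto simp: entry simp del: index_mult_mat(1))
  qed
  moreover have "U * ?A = 1\<^sub>m n" if "?A * U = 1\<^sub>m n"
    using mat_mult_left_right_inverse[OF A U that] .
  ultimately show ?thesis
    using U A by (auto simp: unitary_mat_def inverts_mat_def)
qed

lemma unitary_mat_imp_orthonormal_rows:
  fixes U :: "complex mat"
  assumes U: "U \<in> carrier_mat n n" and "unitary_mat U" "i < n" "j < n"
  shows "(\<Sum>k<n. U $$ (i, k) * cnj (U $$ (j, k))) = (if i = j then 1 else 0)"
proof -
  have "U * mat_adjoint U = 1\<^sub>m n"
    using assms by (simp add: unitary_mat_def inverts_mat_def)
  then have "(U * mat_adjoint U) $$ (i, j) = (if i = j then 1 else 0)"
    using assms by simp
  then show ?thesis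
    using assms by (simp add: mat_adjoint_eq_mat scalar_prod_def atLeast0LessThan)
qed

lemma unitary_mat_transpose:
  fixes U :: "complex mat"
  assumes U: "U \<in> carrier_mat n n" and "unitary_mat U"
  shows "unitary_mat (transpose_mat U)"
proof -
  have "(\<Sum>k<n. cnj (transpose_mat U $$ (k, i)) * transpose_mat U $$ (k, j)) =
      (if i = j then 1 else 0)" if "i < n" "j < n" for i j
    using unitary_mat_imp_orthonormal_rows[OF U assms(2) that(2,1)] U that
    by (auto simp: mult.commute)
  then show ?thesis
    using U by (subst unitary_mat_iff_orthonormal_cols[where n = n]) auto
qed

lemma unitary_mat_permute:
  fixes U :: "complex mat"
  assumes U: "U \<in> carrier_mat n n" "unitary_mat U"
    and p: "p permutes {..<n}" and q: "q permutes {..<n}"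
  shows "unitary_mat (mat n n (\<lambda>(i, j). U $$ (p i, q j)))"
proof -
  let ?V = "mat n n (\<lambda>(i, j). U $$ (p i, q j))"
  have "(\<Sum>k<n. cnj (?V $$ (k, i)) * ?V $$ (k, j)) = (if i = j then 1 else 0)"
    if ij: "i < n" "j < n" for i j
  proof -
    have "(\<Sum>k<n. cnj (?V $$ (k, i)) * ?V $$ (k, j)) =
        (\<Sum>k<n. cnj (U $$ (p k, q i)) * U $$ (p k, q j))"
      using ij by simp
    also have "\<dots> = (\<Sum>k<n. cnj (U $$ (k, q i)) * U $$ (k, q j))"
      by (rule sum.reindex_bij_betw[OF permutes_imp_bij[OF p]])
    also have "\<dots> = (if q i = q j then 1 else 0)"
      using U ij permutes_in_image[OF q] by (simp add: unitary_mat_iff_orthonormal_cols)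
    also have "\<dots> = (if i = j then 1 else 0)"
      using permutes_inj[OF q] by (auto dest: injD)
    finally show ?thesis .
  qed
  then show ?thesis
    by (subst unitary_mat_iff_orthonormal_cols[where n = n]) auto
qed

section \<open>Invariance of the support property\<close>

text \<open>With permutation matrices as indicators of \<open>j = p i\<close>, left multiplication replaces row
  \<open>i\<close> by row \<open>p i\<close>, but right multiplication sends column \<open>k\<close> to column \<open>p' k\<close>; so the column
  permutation obtained here is the inverse of \<open>p'\<close>.\<close>

lemma equivalent_mat_imp_permuted:
  assumes M: "M \<in> carrier_mat n n" and "equivalent_mat M B"
  obtains p q where "p permutes {..<n}" "q permutes {..<n}"
    "B = mat n n (\<lambda>(i, j). M $$ (p i, q j))"
proof -
  from assms obtain p p' where p: "p permutes {..<n}" and p': "p' permutes {..<n}"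
    and B: "B = mat n n (\<lambda>(i, j). if j = p i then 1 else 0) * M *
                mat n n (\<lambda>(i, j). if j = p' i then 1 else 0)"
    by (auto simp: equivalent_mat_def permutation_mat_def)
  let ?P = "mat n n (\<lambda>(i, j). if j = p i then 1 else 0) :: real mat"
  let ?P' = "mat n n (\<lambda>(i, j). if j = p' i then 1 else 0) :: real mat"
  have q: "inv_into UNIV p' permutes {..<n}"
    using p' by (rule permutes_inv)
  have PM: "(?P * M) $$ (i, k) = M $$ (p i, k)" if "i < n" "k < n" for i k
    using that M permutes_in_image[OF p, of i]
    by (simp add: scalar_prod_def if_distrib[of "\<lambda>x. x * _"] sum.delta cong: if_cong)
  have "B $$ (i, j) = M $$ (p i, inv_into UNIV p' j)" if ij: "i < n" "j < n" for i j
  proof -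
    have "B $$ (i, j) = (\<Sum>k = 0..<n. (?P * M) $$ (i, k) * (if j = p' k then 1 else 0))"
      unfolding B using ij M by (simp add: scalar_prod_def del: index_mult_mat(1)
          add: index_mult_mat(1)[of i "?P * M" j ?P'])
    also have "\<dots> = (\<Sum>k = 0..<n. if k = inv_into UNIV p' j then M $$ (p i, k) else 0)"
    proof (intro sum.cong refl)
      fix k assume "k \<in> {0..<n}"
      moreover have "j = p' k \<longleftrightarrow> k = inv_into UNIV p' j"
        using permutes_inv_eq[OF p'] by metis
      ultimately show "(?P * M) $$ (i, k) * (if j = p' k then 1 else 0) =
          (if k = inv_into UNIV p' j then M $$ (p i, k) else 0)"
        using ij PM[of i k] by (simp del: index_mult_mat(1))
    qed
    also have "\<dots> = M $$ (p i, inv_into UNIV p' j)"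
      using ij permutes_in_image[OF q, of j] by (simp add: sum.delta)
    finally show ?thesis .
  qed
  then have "B = mat n n (\<lambda>(i, j). M $$ (p i, inv_into UNIV p' j))"
    using M by (intro eq_matI) (auto simp: B)
  with p q show thesis by (rule that)
qed

lemma supports_unitaries_equivalent:
  assumes M: "M \<in> carrier_mat n n" "supports_unitaries M" and "equivalent_mat M B"
  shows "supports_unitaries B"
proof -
  obtain p q where p: "p permutes {..<n}" and q: "q permutes {..<n}"
    and B: "B = mat n n (\<lambda>(i, j). M $$ (p i, q j))"
    using equivalent_mat_imp_permuted[OF M(1) assms(3)] .
  obtain U where U: "U \<in> carrier_mat n n" "unitary_mat U"
    and supp: "\<And>i j. i < n \<Longrightarrow> j < n \<Longrightarrow> U $$ (i, j) = 0 \<longleftrightarrow> M $$ (i, j) \<noteq> 1"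
    using M by (auto simp: supports_unitaries_def)
  let ?V = "mat n n (\<lambda>(i, j). U $$ (p i, q j))"
  have "U $$ (p i, q j) = 0 \<longleftrightarrow> M $$ (p i, q j) \<noteq> 1" if "i < n" "j < n" for i j
    using that supp permutes_in_image[OF p] permutes_in_image[OF q] by simp
  then show ?thesis
    using unitary_mat_permute[OF U p q]
    by (auto simp: supports_unitaries_def B intro!: bexI[of _ ?V])
qed

lemma supports_unitaries_transpose:
  assumes M: "M \<in> carrier_mat n n" "supports_unitaries M"
  shows "supports_unitaries (transpose_mat M)"
proof -
  obtain U where U: "U \<in> carrier_mat n n" "unitary_mat U"
    and supp: "\<And>i j. i < n \<Longrightarrow> j < n \<Longrightarrow> U $$ (i, j) = 0 \<longleftrightarrow> M $$ (i, j) \<noteq> 1"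
    using M by (auto simp: supports_unitaries_def)
  then show ?thesis
    using M unitary_mat_transpose[OF U]
    by (auto simp: supports_unitaries_def intro!: bexI[of _ "transpose_mat U"])
qed

section \<open>The block matrix\<close>

text \<open>As \<open>a1\<close> and \<open>b2\<close> are nonzero, \<open>(a1, 0, a3)\<close> and \<open>(0, b2, b3)\<close> span a plane,
  whose orthogonal complement is a line; both \<open>c\<close> and \<open>d\<close> lie on that line, so \<open>d = r c\<close>
  with \<open>r\<close> read off from the third entries, and the inner product is \<open>r\<close> times the squared norm
  of \<open>c\<close>.\<close>

lemma no_orthogonal_pair_over_Q:
  fixes a1 a3 b2 b3 c1 c2 c3 d1 d2 d3 :: complex
  assumes "a1 \<noteq> 0" "b2 \<noteq> 0" "c3 \<noteq> 0" "d3 \<noteq> 0"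
    and ac: "cnj a1 * c1 + cnj a3 * c3 = 0" and ad: "cnj a1 * d1 + cnj a3 * d3 = 0"
    and bc: "cnj b2 * c2 + cnj b3 * c3 = 0" and bd: "cnj b2 * d2 + cnj b3 * d3 = 0"
  shows "cnj c1 * d1 + cnj c2 * d2 + cnj c3 * d3 \<noteq> 0"
proof
  assume cd: "cnj c1 * d1 + cnj c2 * d2 + cnj c3 * d3 = 0"
  define r where "r = d3 / c3"
  have "cnj a1 * (c3 * d1 - c1 * d3) =
      c3 * (cnj a1 * d1 + cnj a3 * d3) - d3 * (cnj a1 * c1 + cnj a3 * c3)"
    by (simp add: algebra_simps)
  then have "cnj a1 * (c3 * d1 - c1 * d3) = 0"
    by (simp only: ac ad mult_zero_right diff_self)
  then have d1: "d1 = r * c1"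
    using assms(1,3) by (simp add: r_def field_simps)
  have "cnj b2 * (c3 * d2 - c2 * d3) =
      c3 * (cnj b2 * d2 + cnj b3 * d3) - d3 * (cnj b2 * c2 + cnj b3 * c3)"
    by (simp add: algebra_simps)
  then have "cnj b2 * (c3 * d2 - c2 * d3) = 0"
    by (simp only: bc bd mult_zero_right diff_self)
  then have d2: "d2 = r * c2"
    using assms(2,3) by (simp add: r_def field_simps)
  have d3: "d3 = r * c3"
    using assms(3) by (simp add: r_def)
  have "r * (c1 * cnj c1 + c2 * cnj c2 + c3 * cnj c3) = 0"
    using cd unfolding d1 d2 d3 by (simp add: algebra_simps)
  then have "c1 * cnj c1 + c2 * cnj c2 + c3 * cnj c3 = 0"
    using assms(3,4) by (simp add: r_def)
  then have "complex_of_real ((cmod c1)\<^sup>2 + (cmod c2)\<^sup>2 + (cmod c3)\<^sup>2) = 0"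
    by (simp only: of_real_add complex_norm_square)
  then have "(cmod c1)\<^sup>2 + (cmod c2)\<^sup>2 + (cmod c3)\<^sup>2 = 0"
    by (simp only: of_real_eq_0_iff)
  then have "(cmod c3)\<^sup>2 = 0"
    by (smt (verit) zero_le_power2)
  then show False using assms(3) by simp
qed

text \<open>The inner product counts the rows in which both columns have a one.\<close>

lemma orthogonal_zero_one_cols_disjoint:
  assumes A: "A \<in> carrier_mat m r" "zero_one_mat A" and B: "B \<in> carrier_mat m s" "zero_one_mat B"
    and ij: "i < r" "j < s" and orth: "col A i \<bullet> col B j = 0" and k: "k < m"
  shows "\<not> (A $$ (k, i) = 1 \<and> B $$ (k, j) = 1)"
proof -
  have nonneg: "0 \<le> A $$ (l, i)" "0 \<le> B $$ (l, j)" if "l < m" for l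
    using that A B ij elements_matI[of A m r l i] elements_matI[of B m s l j]
    by (force simp: zero_one_mat_def)+
  have "(\<Sum>l = 0..<m. A $$ (l, i) * B $$ (l, j)) = 0"
    using orth A B ij by (simp add: scalar_prod_def)
  then have "A $$ (k, i) * B $$ (k, j) = 0"
    using k nonneg by (subst (asm) sum_nonneg_eq_0_iff) auto
  then show ?thesis by auto
qed

text \<open>This passes from the orthogonality of columns of length \<open>n\<close> to that of their top
  parts, which for \<open>m = 3\<close> are the rows over \<open>Q\<close>: the disjoint supports make every later term of the inner product vanish.\<close>

lemma orthogonal_cols_truncated:
  fixes U :: "complex mat"
  assumes "U \<in> carrier_mat n n" "unitary_mat U" "i < n" "j < n" "i \<noteq> j" "m \<le> n"
    and disjoint: "\<And>k. m \<le> k \<Longrightarrow> k < n \<Longrightarrow> U $$ (k, i) = 0 \<or> U $$ (k, j) = 0"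
  shows "(\<Sum>k<m. cnj (U $$ (k, i)) * U $$ (k, j)) = 0"
proof -
  have "(\<Sum>k<m. cnj (U $$ (k, i)) * U $$ (k, j)) = (\<Sum>k<n. cnj (U $$ (k, i)) * U $$ (k, j))"
    using assms(6) disjoint by (intro sum.mono_neutral_left) (auto simp: not_less)
  also have "\<dots> = 0"
    using assms(1-5) by (simp add: unitary_mat_iff_orthonormal_cols)
  finally show ?thesis .
qed

lemma block_mat_not_supports_unitaries:
  assumes n: "4 \<le> n"
    and X: "X \<in> carrier_mat (n - 3) 2" "zero_one_mat X"
    and Y: "Y \<in> carrier_mat (n - 3) 2" "zero_one_mat Y"
    and S: "S \<in> carrier_mat 3 (n - 4)" and T: "T \<in> carrier_mat (n - 3) (n - 4)"
    and B: "B = four_block_mat Q_mat (J_mat 3 2 @\<^sub>c S) X (Y @\<^sub>c T)"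
    and Y_orth: "\<forall>i < 2. \<forall>j < 2. i \<noteq> j \<longrightarrow> col Y i \<bullet> col Y j = 0"
    and XY_orth: "\<forall>i < 2. \<forall>j < 2. col X i \<bullet> col Y j = 0"
  shows "\<not> supports_unitaries B"
proof
  assume "supports_unitaries B"
  have Q: "Q_mat \<in> carrier_mat 3 2"
    by (intro carrier_matI) (simp_all add: Q_mat_def mat_of_rows_list_def)
  have dims: "B \<in> carrier_mat n n"
    using n Q X Y S T by (auto simp: B append_cols_def J_mat_def)
  obtain U where U: "U \<in> carrier_mat n n" "unitary_mat U"
    and supp: "\<And>i j. i < n \<Longrightarrow> j < n \<Longrightarrow> U $$ (i, j) \<noteq> 0 \<longleftrightarrow> B $$ (i, j) = 1"
    using \<open>supports_unitaries B\<close> dims by (auto simp: supports_unitaries_def)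
  have left: "B $$ (k, i) = (if k < 3 then Q_mat $$ (k, i) else X $$ (k - 3, i))"
    if "k < n" "i < 2" for k i
    using that n Q X Y S T by (auto simp: B append_cols_def J_mat_def)
  have right: "B $$ (k, i + 2) = (if k < 3 then 1 else Y $$ (k - 3, i))"
    if "k < n" "i < 2" for k i
    using that n Q X Y S T by (auto simp: B append_cols_def J_mat_def)
  have XY: "(\<Sum>k<3. cnj (U $$ (k, i)) * U $$ (k, j + 2)) = 0" if ij: "i < 2" "j < 2" for i j
  proof (rule orthogonal_cols_truncated[OF U])
    fix k assume k: "3 \<le> k" "k < n"
    have "\<not> (X $$ (k - 3, i) = 1 \<and> Y $$ (k - 3, j) = 1)"
      using XY_orth ij k by (intro orthogonal_zero_one_cols_disjoint[OF X Y ij]) auto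
    then show "U $$ (k, i) = 0 \<or> U $$ (k, j + 2) = 0"
      using supp[of k i] supp[of k "j + 2"] left[of k i] right[of k j] k n ij by auto
  qed (use ij n in auto)
  have YY: "(\<Sum>k<3. cnj (U $$ (k, 2)) * U $$ (k, 3)) = 0"
  proof (rule orthogonal_cols_truncated[OF U])
    fix k assume k: "3 \<le> k" "k < n"
    have "\<not> (Y $$ (k - 3, 0) = 1 \<and> Y $$ (k - 3, 1) = 1)"
      using Y_orth k by (intro orthogonal_zero_one_cols_disjoint[OF Y Y]) auto
    then show "U $$ (k, 2) = 0 \<or> U $$ (k, 3) = 0"
      using supp[of k 2] supp[of k 3] right[of k 0] right[of k 1] k n
      by (auto simp: numeral_eq_Suc)
  qed (use n in auto)
  have Q_entries: "Q_mat $$ (0, 0) = 1" "Q_mat $$ (1, 0) = 0"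
      "Q_mat $$ (0, 1) = 0" "Q_mat $$ (1, 1) = 1"
    by (simp_all add: Q_mat_def mat_of_rows_list_def)
  have zero: "U $$ (1, 0) = 0" "U $$ (0, 1) = 0"
    using supp[of 1 0] supp[of 0 1] left[of 1 0] left[of 0 1] Q_entries n by auto
  have nonzero: "U $$ (0, 0) \<noteq> 0" "U $$ (1, 1) \<noteq> 0" "U $$ (2, 2) \<noteq> 0" "U $$ (2, 3) \<noteq> 0"
    using supp[of 0 0] supp[of 1 1] supp[of 2 2] supp[of 2 3] left[of 0 0] left[of 1 1]
      right[of 2 0] right[of 2 1] Q_entries n
    by (auto simp: numeral_eq_Suc)
  have sum3: "(\<Sum>k<3. f k) = f 0 + f 1 + f 2" for f :: "nat \<Rightarrow> complex"
    by (simp add: numeral_eq_Suc)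
  have two_three: "0 + 2 = (2 :: nat)" "1 + 2 = (3 :: nat)" by simp_all
  have ac: "cnj (U $$ (0, 0)) * U $$ (0, 2) + cnj (U $$ (2, 0)) * U $$ (2, 2) = 0"
    using XY[of 0 0] zero unfolding sum3 two_three by simp
  have ad: "cnj (U $$ (0, 0)) * U $$ (0, 3) + cnj (U $$ (2, 0)) * U $$ (2, 3) = 0"
    using XY[of 0 1] zero unfolding sum3 two_three by simp
  have bc: "cnj (U $$ (1, 1)) * U $$ (1, 2) + cnj (U $$ (2, 1)) * U $$ (2, 2) = 0"
    using XY[of 1 0] zero unfolding sum3 two_three by simp
  have bd: "cnj (U $$ (1, 1)) * U $$ (1, 3) + cnj (U $$ (2, 1)) * U $$ (2, 3) = 0"
    using XY[of 1 1] zero unfolding sum3 two_three by simp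
  have "cnj (U $$ (0, 2)) * U $$ (0, 3) + cnj (U $$ (1, 2)) * U $$ (1, 3) +
      cnj (U $$ (2, 2)) * U $$ (2, 3) \<noteq> 0"
    by (rule no_orthogonal_pair_over_Q[OF nonzero ac ad bc bd])
  with YY show False by (simp only: sum3)
qed

theorem theorem3p4:
  fixes n :: nat and M B X Y S T :: "real mat"
  assumes M: "M \<in> carrier_mat n n" "zero_one_mat M"
    and X: "X \<in> carrier_mat (n - 3) 2" "zero_one_mat X"
    and Y: "Y \<in> carrier_mat (n - 3) 2" "zero_one_mat Y"
    and S: "S \<in> carrier_mat 3 (n - 4)" "zero_one_mat S"
    and T: "T \<in> carrier_mat (n - 3) (n - 4)" "zero_one_mat T"
    and B: "B = four_block_mat Q_mat (J_mat 3 2 @\<^sub>c S)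
                               X     (Y @\<^sub>c T)"
    and equiv: "equivalent_mat M B \<or> equivalent_mat (transpose_mat M) B"
    and Y_orth: "\<forall>i < 2. \<forall>j < 2. i \<noteq> j \<longrightarrow> col Y i \<bullet> col Y j = 0"
    and XY_orth: "\<forall>i < 2. \<forall>j < 2. col X i \<bullet> col Y j = 0"
  shows "\<not> supports_unitaries M"
proof
  assume supports: "supports_unitaries M"
  have Mt: "transpose_mat M \<in> carrier_mat n n"
    using M by simp
  have "dim_col B = n"
    using equiv equivalent_mat_imp_permuted[OF M(1)] equivalent_mat_imp_permuted[OF Mt]
    by (metis dim_col_mat(1))
  \<comment> \<open>For \<open>n < 4\<close> the truncated subtraction leaves \<open>B\<close> with four columns, too many for a matrix
    equivalent to an \<open>n\<close> by \<open>n\<close> one.\<close>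
  moreover have "4 \<le> dim_col B"
    using Y T by (auto simp: B append_cols_def Q_mat_def mat_of_rows_list_def)
  ultimately have "4 \<le> n" by simp
  then have "\<not> supports_unitaries B"
    using block_mat_not_supports_unitaries X Y S(1) T(1) B Y_orth XY_orth by blast
  moreover have "supports_unitaries B"
    using equiv supports_unitaries_equivalent[OF M(1) supports]
      supports_unitaries_equivalent[OF Mt supports_unitaries_transpose[OF M(1) supports]]
    by blast
  ultimately show False by contradiction
qed

end
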